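(* Let $c(t)\ge2\ell$ for all $t\in\mathbb{N}$. Then, with the personalized incentives described in the context, the mapping $\boldsymbol{x}\mapsto F(\boldsymbol{x};t)$ is $\ell$-strongly monotone for all $t\in\mathbb{N}$, i.e. $(\boldsymbol{x}-\boldsymbol{y})^\top(F(\boldsymbol{x};t)-F(\boldsymbol{y};t))\ge\ell\|\boldsymbol{x}-\boldsymbol{y}\|^2$ for all $\boldsymbol{x},\boldsymbol{y}\in\Omega$.
   Context: Setting (time-varying game). There are $N$ agents indexed by $\mathcal{I}=\{1,\ldots,N\}$; agent $i$ controls $x_i\in\mathcal{X}_i\subseteq\mathbb{R}^{n_i}$, $n=\sum_i n_i$, $\boldsymbol{x}=(x_1,\ldots,x_N)=(x_i,\boldsymbol{x}_{-i})\in\mathbb{R}^n$, $\mathcal{X}=\prod_i\mathcal{X}_i$. At each discrete time $t\in\mathbb{N}$ agent $i$ minimizes its private cost $g_i(x_i,\boldsymbol{x}_{-i};t)$, $g_i:\mathbb{R}^n\times\mathbb{N}\to\mathbb{R}$, over $x_i\in\mathcal{X}_i$ subject to $h(\boldsymbol{x}):=\sum_jh_j(x_j)\le0$, $h_j:\mathbb{R}^{n_j}\to\mathbb{R}^m$. The feasible set is $\Omega:=\{\boldsymbol{x}\in\mathcal{X}:h(\boldsymbol{x})\le0\}$, and $G(\boldsymbol{x};t):=\mathrm{col}((\nabla_{x_i}g_i(x_i,\boldsymbol{x}_{-i};t))_{i\in\mathcal{I}})$. Standing assumptions. For all $t\in\mathbb{N}$: (1) for each $i\in\mathcal{I}$,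 the mapping $x_i\mapsto g_i(x_i,\boldsymbol{x}_{-i};t)$ is of class $\mathcal{C}^1$ and has an $\ell_i$-Lipschitz continuous gradient; $\ell:=\sum_{i\in\mathcal{I}}\ell_i$. (2) Each $\mathcal{X}_i$ is nonempty, compact and convex, and each $h_i$ is convex and of class $\mathcal{C}^1$. (3) The Jacobian of $G(\cdot;t)$ is symmetric at every point of $\Omega$; accordingly there is a differentiable (potential) function $\theta:\mathbb{R}^n\times\mathbb{N}\to\mathbb{R}$, possibly unknown, with $G(\boldsymbol{x};t)=\nabla\theta(\boldsymbol{x};t)$ for all $\boldsymbol{x}\in\Omega$. (4) The set of (local and global) minimizers of $\theta(\cdot;t)$ over $\Omega$ is nonempty. Personalized incentives. Given the previous equilibrium point $\boldsymbol{x}^\star_{t-1}\in\Omega$ and an estimate $\nabla_{x_i}\hat g_{i,t-1}(\boldsymbol{x}^\star_{t-1};t-1)\in\mathbb{R}^{n_i}$ of $\nabla_{x_i}g_i(\boldsymbol{x}^\star_{t-1};t-1)$, agent $i$ receives the incentive $u_i(\boldsymbol{x};t)=\tfrac12c(t)\|x_i-x_i^+(t)\|^2$, with $x_i^+(t):=x^\star_{i,t-1}+\xi(t)\nabla_{x_i}\hat g_{i,t-1}(\boldsymbol{x}^\star_{t-1};t-1)$ and parameters $c(t),\xi(t)\ge0$. Then $F(\boldsymbol{x};t):=\mathrm{col}\big((\nabla_{x_i}(g_i+u_i)(x_i,\boldsymbol{x}_{-i};t))_{i\in\mathcal{I}}\big)$.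
   Formalization: The gradient of g_i in x_i is assumed ℓ_i-Lipschitz in the whole joint vector x on R^n, not only in x_i for fixed x_{-i}; with the latter the claim fails, e.g. for g_1 = g_2 = a·x_1·x_2 with a > ℓ and c = 2ℓ. *)

theory Defs
  imports "HOL-Analysis.Analysis"
begin

text \<open>
  Encoding of the product space. The agents form a finite type \<open>'i\<close>, the scalar coordinates of the
  joint decision vector a finite type \<open>'k\<close>, and \<open>owner k\<close> is the agent that controls coordinate
  \<open>k\<close>. So the dimension of agent \<open>i\<close> is \<open>n\<^sub>i = card {k. owner k = i}\<close>, dimensions may differ between
  agents, and the dimension of the joint space is \<open>CARD('k)\<close>, the sum of the \<open>n\<^sub>i\<close>. The decision
  space of agent \<open>i\<close> is the coordinate subspace \<open>agent_space owner i\<close>, with the norm, inner product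
  and topology induced by the joint space.
\<close>

definition agent_space :: "('k::finite \<Rightarrow> 'i) \<Rightarrow> 'i \<Rightarrow> (real^'k) set" where
  "agent_space owner i = {v. \<forall>k. owner k \<noteq> i \<longrightarrow> v $ k = 0}"

definition block :: "('k::finite \<Rightarrow> 'i) \<Rightarrow> 'i \<Rightarrow> real^'k \<Rightarrow> real^'k" where
  "block owner i x = (\<chi> k. if owner k = i then x $ k else 0)"

text \<open>The joint vector in which agent \<open>i\<close> plays its block of \<open>z\<close> and the others play as in \<open>x\<close>.\<close>

definition with_block :: "('k::finite \<Rightarrow> 'i) \<Rightarrow> 'i \<Rightarrow> real^'k \<Rightarrow> real^'k \<Rightarrow> real^'k" where
  "with_block owner i z x = (\<chi> k. if owner k = i then z $ k else x $ k)"

definition col :: "('k::finite \<Rightarrow> 'i) \<Rightarrow> ('i \<Rightarrow> real^'k) \<Rightarrow> real^'k" where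
  "col owner v = (\<chi> k. v (owner k) $ k)"

text \<open>
  The function \<open>z \<mapsto> f (with_block owner i z x)\<close> depends only on block \<open>i\<close> of \<open>z\<close>, so its gradient
  vanishes outside that block and is the gradient with respect to the decision of agent \<open>i\<close>.
  Functions of one block are treated in the same way below: they are composed with the projection
  onto the block, which affects neither convexity nor smoothness.

  Since \<open>partial_gradient owner i f\<close> is a function of the joint vector, its Lipschitz continuity is
  with respect to all decisions. Lipschitz continuity in the decision of agent \<open>i\<close> alone would give
  no control over the cross-derivatives of the pseudo-gradient.
\<close>

definition partial_gradient ::
    "('k::finite \<Rightarrow> 'i) \<Rightarrow> 'i \<Rightarrow> (real^'k \<Rightarrow> real) \<Rightarrow> real^'k \<Rightarrow> real^'k" where
  "partial_gradient owner i f x = (THE D. GDERIV (\<lambda>z. f (with_block owner i z x)) x :> D)"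

definition pseudo_gradient ::
    "('k::finite \<Rightarrow> 'i) \<Rightarrow> ('i \<Rightarrow> real^'k \<Rightarrow> real) \<Rightarrow> real^'k \<Rightarrow> real^'k" where
  "pseudo_gradient owner f x = col owner (\<lambda>i. partial_gradient owner i (f i) x)"

definition class_C1 :: "('a::real_normed_vector \<Rightarrow> 'b::real_normed_vector) \<Rightarrow> bool" where
  "class_C1 f \<longleftrightarrow> (\<exists>f' :: 'a \<Rightarrow> 'a \<Rightarrow>\<^sub>L 'b.
     (\<forall>x. (f has_derivative blinfun_apply (f' x)) (at x)) \<and> continuous_on UNIV f')"

text \<open>The order on \<open>real^'m\<close> is componentwise.\<close>

definition feasible_set ::
    "('k::finite \<Rightarrow> 'i::finite) \<Rightarrow> ('i \<Rightarrow> (real^'k) set) \<Rightarrow> ('i \<Rightarrow> real^'k \<Rightarrow> real^'m) \<Rightarrow> (real^'k) set"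
  where
  "feasible_set owner X h =
     {x. (\<forall>i. block owner i x \<in> X i) \<and> (\<Sum>j\<in>UNIV. h j (block owner j x)) \<le> 0}"

definition global_minimizers :: "'a set \<Rightarrow> ('a \<Rightarrow> real) \<Rightarrow> 'a set" where
  "global_minimizers S f = {x \<in> S. \<forall>y\<in>S. f x \<le> f y}"

definition local_minimizers :: "'a::topological_space set \<Rightarrow> ('a \<Rightarrow> real) \<Rightarrow> 'a set" where
  "local_minimizers S f = {x \<in> S. \<exists>U. open U \<and> x \<in> U \<and> (\<forall>y\<in>S \<inter> U. f x \<le> f y)}"

text \<open>
  Here \<open>p\<close> is the previous equilibrium point and \<open>d i\<close> the estimate, at \<open>p\<close>, of the gradient of the
  previous cost of agent \<open>i\<close> with respect to its own decision.
\<close>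

definition incentive_target ::
    "('k::finite \<Rightarrow> 'i) \<Rightarrow> real \<Rightarrow> real^'k \<Rightarrow> ('i \<Rightarrow> real^'k) \<Rightarrow> 'i \<Rightarrow> real^'k" where
  "incentive_target owner \<xi> p d i = block owner i p + \<xi> *\<^sub>R d i"

definition incentive ::
    "('k::finite \<Rightarrow> 'i) \<Rightarrow> real \<Rightarrow> real \<Rightarrow> real^'k \<Rightarrow> ('i \<Rightarrow> real^'k) \<Rightarrow> 'i \<Rightarrow> real^'k \<Rightarrow> real" where
  "incentive owner c \<xi> p d i x =
     1/2 * c * (norm (block owner i x - incentive_target owner \<xi> p d i))\<^sup>2"

definition strongly_monotone_on :: "'a::real_inner set \<Rightarrow> real \<Rightarrow> ('a \<Rightarrow> 'a) \<Rightarrow> bool" where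
  "strongly_monotone_on S \<mu> F \<longleftrightarrow>
     (\<forall>x\<in>S. \<forall>y\<in>S. (x - y) \<bullet> (F x - F y) \<ge> \<mu> * (norm (x - y))\<^sup>2)"

end

theory Submission
  imports Defs
begin

text \<open>
  Adding the incentive of agent \<open>i\<close> adds the affine map \<open>c \<cdot> (block i x - target)\<close> to the partial
  gradient of that agent. Stacked over all agents these maps form \<open>c \<cdot> x\<close> plus a constant
  (\<open>pseudo_gradient_add_incentive\<close>), which contributes exactly \<open>c \<cdot> \<parallel>x - y\<parallel>\<^sup>2\<close> to
  \<open>(x - y) \<bullet> (F x - F y)\<close>.

  The pseudo-gradient of the original costs cannot contribute less than \<open>- L \<cdot> \<parallel>x - y\<parallel>\<^sup>2\<close>: the inner
  product splits into one term per agent (\<open>inner_col\<close>), and by Cauchy-Schwarz and the Lipschitz bound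
  the term of agent \<open>i\<close> is at least \<open>- l i \<cdot> \<parallel>x - y\<parallel>\<^sup>2\<close> (\<open>pseudo_gradient_weakly_monotone\<close>).
  With \<open>c \<ge> 2 * L\<close> the total is at least \<open>(2 * L - L) \<cdot> \<parallel>x - y\<parallel>\<^sup>2\<close>.
\<close>

lemma differentiable_imp_GDERIV:
  fixes f :: "'a::euclidean_space \<Rightarrow> real"
  assumes "f differentiable (at x)"
  obtains D where "GDERIV f x :> D"
proof -
  obtain f' where f': "(f has_derivative f') (at x)"
    using assms by (auto simp: differentiable_def)
  have "v \<bullet> adjoint f' 1 = f' v" for v
    using adjoint_works[OF has_derivative_linear[OF f'], of v 1] by simp
  with f' have "GDERIV f x :> adjoint f' 1"
    by (simp add: gderiv_def)
  then show thesis by (rule that)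
qed

lemma GDERIV_unique:
  assumes "GDERIV f x :> D" "GDERIV f x :> E"
  shows "D = E"
proof -
  have "(\<lambda>v. v \<bullet> D) = (\<lambda>v. v \<bullet> E)"
    using assms unfolding gderiv_def by (rule has_derivative_unique)
  then have "(D - E) \<bullet> (D - E) = 0"
    by (metis inner_diff_right right_minus_eq)
  then show ?thesis by simp
qed

lemma partial_gradient_eqI:
  assumes "GDERIV (\<lambda>z. f (with_block owner i z x)) x :> D"
  shows "partial_gradient owner i f x = D"
  unfolding partial_gradient_def using assms GDERIV_unique by blast

lemma partial_gradient_add:
  assumes "GDERIV (\<lambda>z. f (with_block owner i z x)) x :> D"
    and "GDERIV (\<lambda>z. u (with_block owner i z x)) x :> E"
  shows "partial_gradient owner i (\<lambda>x. f x + u x) x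
    = partial_gradient owner i f x + partial_gradient owner i u x"
  using partial_gradient_eqI[OF assms(1)] partial_gradient_eqI[OF assms(2)]
    partial_gradient_eqI[OF GDERIV_add[OF assms]] by simp

lemma block_with_block [simp]: "block owner i (with_block owner i z x) = block owner i z"
  by (simp add: block_def with_block_def vec_eq_iff)

lemma inner_block: "block owner i x \<bullet> y = x \<bullet> block owner i y"
  by (simp add: block_def inner_vec_def) (rule sum.cong; simp)

lemma bounded_linear_block: "bounded_linear (block owner i)"
  by (intro linear_conv_bounded_linear[THEN iffD1] linearI)
    (auto simp: block_def vec_eq_iff)

lemma norm_block_le: "norm (block owner i x) \<le> norm x"
  by (rule norm_le_componentwise_cart) (simp add: block_def)

text \<open>
  The outer \<open>block\<close> comes from the chain rule: the projection is self-adjoint, so it moves from the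
  direction of differentiation onto the gradient.
\<close>

lemma GDERIV_incentive:
  "GDERIV (\<lambda>z. incentive owner c \<xi> p d i (with_block owner i z x)) x
     :> c *\<^sub>R block owner i (block owner i x - incentive_target owner \<xi> p d i)"
  unfolding gderiv_def incentive_def block_with_block power2_norm_eq_inner
  by (rule derivative_eq_intros bounded_linear.has_derivative[OF bounded_linear_block] refl)+
    (simp add: fun_eq_iff inner_block[symmetric] inner_commute)

text \<open>
  The targets enter only through a constant, so they drop out of differences of the pseudo-gradient.
\<close>

lemma pseudo_gradient_add_incentive:
  assumes "\<And>i x. class_C1 (\<lambda>z. f i (with_block owner i z x))"
  shows "pseudo_gradient owner (\<lambda>i x. f i x + incentive owner c \<xi> p d i x) x
    = pseudo_gradient owner f x + c *\<^sub>R (x - col owner (incentive_target owner \<xi> p d))"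
proof -
  have "partial_gradient owner i (\<lambda>x. f i x + incentive owner c \<xi> p d i x) x
      = partial_gradient owner i (f i) x
        + c *\<^sub>R block owner i (block owner i x - incentive_target owner \<xi> p d i)" for i
  proof -
    have "(\<lambda>z. f i (with_block owner i z x)) differentiable (at x)"
      using assms[of i x] by (auto simp: class_C1_def differentiable_def)
    then obtain D where "GDERIV (\<lambda>z. f i (with_block owner i z x)) x :> D"
      by (rule differentiable_imp_GDERIV)
    from partial_gradient_add[OF this GDERIV_incentive] partial_gradient_eqI[OF GDERIV_incentive]
    show ?thesis by metis
  qed
  then show ?thesis
    by (simp add: pseudo_gradient_def col_def block_def vec_eq_iff)
qed

lemma inner_col:
  fixes owner :: "'k::finite \<Rightarrow> 'i::finite"
  shows "x \<bullet> col owner v = (\<Sum>i\<in>UNIV. block owner i x \<bullet> v i)"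
proof -
  have "(\<Sum>i\<in>UNIV. block owner i x \<bullet> v i)
      = (\<Sum>k\<in>UNIV. \<Sum>i\<in>UNIV. if owner k = i then x $ k * v i $ k else 0)"
    unfolding inner_vec_def block_def
    by (subst sum.swap) (intro sum.cong; simp)
  then show ?thesis by (simp add: inner_vec_def col_def)
qed

text \<open>
  Lipschitz continuity in the joint vector is what bounds the effect of the other agents' decisions
  on the partial gradient of agent \<open>i\<close>; the projection onto block \<open>i\<close> only shrinks \<open>x - y\<close>.
\<close>

lemma pseudo_gradient_weakly_monotone:
  fixes owner :: "'k::finite \<Rightarrow> 'i::finite"
  assumes "\<And>i. (l i)-lipschitz_on UNIV (partial_gradient owner i (f i))"
  shows "(x - y) \<bullet> (pseudo_gradient owner f x - pseudo_gradient owner f y)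
    \<ge> - (\<Sum>i\<in>UNIV. l i) * (norm (x - y))\<^sup>2"
proof -
  define w where "w i = partial_gradient owner i (f i) x - partial_gradient owner i (f i) y" for i
  have "block owner i (x - y) \<bullet> w i \<ge> - (l i * (norm (x - y))\<^sup>2)" for i
  proof -
    have "norm (w i) \<le> l i * norm (x - y)"
      using lipschitz_onD[OF assms[of i], of x y] by (simp add: w_def dist_norm)
    then have "norm (block owner i (x - y)) * norm (w i) \<le> norm (x - y) * (l i * norm (x - y))"
      by (intro mult_mono norm_block_le) auto
    then show ?thesis
      using Cauchy_Schwarz_ineq2[of "block owner i (x - y)" "w i"]
      by (simp add: power2_eq_square algebra_simps)
  qed
  then have "(\<Sum>i\<in>UNIV. - (l i * (norm (x - y))\<^sup>2)) \<le> (\<Sum>i\<in>UNIV. block owner i (x - y) \<bullet> w i)"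
    by (intro sum_mono)
  also have "\<dots> = (x - y) \<bullet> col owner w"
    by (simp add: inner_col)
  also have "col owner w = pseudo_gradient owner f x - pseudo_gradient owner f y"
    by (simp add: pseudo_gradient_def col_def w_def vec_eq_iff)
  finally show ?thesis
    by (simp add: sum_negf sum_distrib_right)
qed

theorem proposition1:
  fixes owner :: "'k::finite \<Rightarrow> 'i::finite"
    and g :: "'i \<Rightarrow> real^'k \<Rightarrow> nat \<Rightarrow> real"
    and X :: "'i \<Rightarrow> (real^'k) set"
    and h :: "'i \<Rightarrow> real^'k \<Rightarrow> real^'m"
    and l :: "'i \<Rightarrow> real"
    and \<theta> :: "real^'k \<Rightarrow> nat \<Rightarrow> real"
    and c \<xi> :: "nat \<Rightarrow> real"
    and x_prev :: "nat \<Rightarrow> real^'k"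
    and grad_est :: "nat \<Rightarrow> 'i \<Rightarrow> real^'k"
  defines "\<Omega> \<equiv> feasible_set owner X h"
    and "G \<equiv> (\<lambda>t. pseudo_gradient owner (\<lambda>i x. g i x t))"
    and "F \<equiv> (\<lambda>t. pseudo_gradient owner
           (\<lambda>i x. g i x t + incentive owner (c t) (\<xi> t) (x_prev t) (grad_est t) i x))"
    and "L \<equiv> (\<Sum>i\<in>UNIV. l i)"
  assumes g_C1: "\<And>t i x. class_C1 (\<lambda>z. g i (with_block owner i z x) t)"
    and g_lipschitz: "\<And>t i. (l i)-lipschitz_on UNIV (partial_gradient owner i (\<lambda>x. g i x t))"
    and X_sub: "\<And>i. X i \<subseteq> agent_space owner i"
    and X_nonempty: "\<And>i. X i \<noteq> {}"
    and X_compact: "\<And>i. compact (X i)"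
    and X_convex: "\<And>i. convex (X i)"
    and h_convex: "\<And>i j. convex_on UNIV (\<lambda>x. h i (block owner i x) $ j)"
    and h_C1: "\<And>i. class_C1 (\<lambda>x. h i (block owner i x))"
    and G_differentiable: "\<And>t x. x \<in> \<Omega> \<Longrightarrow> G t differentiable (at x)"
    and jacobian_symmetric:
      "\<And>t x. x \<in> \<Omega> \<Longrightarrow> transpose (jacobian (G t) (at x)) = jacobian (G t) (at x)"
    and potential_differentiable: "\<And>t x. (\<lambda>x. \<theta> x t) differentiable (at x)"
    and potential_gradient: "\<And>t x. x \<in> \<Omega> \<Longrightarrow> GDERIV (\<lambda>x. \<theta> x t) x :> G t x"
    and minimizers_nonempty:
      "\<And>t. local_minimizers \<Omega> (\<lambda>x. \<theta> x t) \<union> global_minimizers \<Omega> (\<lambda>x. \<theta> x t) \<noteq> {}"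
    and x_prev_feasible: "\<And>t. x_prev t \<in> \<Omega>"
    and grad_est_space: "\<And>t i. grad_est t i \<in> agent_space owner i"
    and c_nonneg: "\<And>t. c t \<ge> 0"
    and \<xi>_nonneg: "\<And>t. \<xi> t \<ge> 0"
    and c_large: "\<And>t. c t \<ge> 2 * L"
  shows "\<forall>t. strongly_monotone_on \<Omega> L (F t)"
proof
  fix t
  have L_le: "L * (norm (x - y))\<^sup>2 \<le> (c t - L) * (norm (x - y))\<^sup>2" for x y :: "real^'k"
    using c_large[of t] by (intro mult_right_mono) auto
  show "strongly_monotone_on \<Omega> L (F t)"
    unfolding strongly_monotone_on_def
  proof (intro ballI)
    fix x y :: "real^'k"
    have "F t x - F t y = (G t x - G t y) + c t *\<^sub>R (x - y)"
      unfolding F_def G_def pseudo_gradient_add_incentive[OF g_C1]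
      by (simp add: algebra_simps)
    then have "(x - y) \<bullet> (F t x - F t y) = (x - y) \<bullet> (G t x - G t y) + c t * (norm (x - y))\<^sup>2"
      by (simp add: inner_add_right power2_norm_eq_inner)
    also have "\<dots> \<ge> - L * (norm (x - y))\<^sup>2 + c t * (norm (x - y))\<^sup>2"
      unfolding G_def L_def
      by (intro add_right_mono pseudo_gradient_weakly_monotone g_lipschitz)
    finally show "(x - y) \<bullet> (F t x - F t y) \<ge> L * (norm (x - y))\<^sup>2"
      using L_le[of x y] by (simp add: algebra_simps)
  qed
qed

end
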